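(* Let $\mathcal{P}$ be a hereditary abstract $n$-polytope each of whose facets is either regular or chiral. Then either every facet of $\mathcal{P}$ is regular, or every facet of $\mathcal{P}$ is chiral.
   Context: An abstract $n$-polytope is a partially ordered set $\mathcal{P}$ with a strictly monotone rank function onto $\{-1,0,\ldots,n\}$, with a least face $F_{-1}$ and a greatest face $F_n$, in which every flag (maximal chain) has exactly $n+2$ elements, which is strongly flag-connected, and which satisfies the diamond condition. Elements of rank $n-1$ are facets; a facet $F$ is identified with the section $F/F_{-1}=\{H:F_{-1}\le H\le F\}$. Two flags are adjacent if they differ in exactly one face. A polytope is regular if its automorphism group acts transitively on its flags, and chiral if its automorphism group has exactly two orbits on flags with adjacent flags always in different orbits. $\mathcal{P}$ is hereditary if for every facet $F$, every automorphism of $F/F_{-1}$ extends to an automorphism of $\mathcal{P}$ (which then fixes $F$). *)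

theory Defs
  imports Main
begin

text \<open>
  A poset is a set \<open>P\<close> of elements of an arbitrary ordered type, with the inherited order; sections
  of \<open>P\<close> are then simply subsets of \<open>P\<close>.
\<close>

definition flags :: "'a::order set \<Rightarrow> 'a set set" where
  "flags P = {\<Phi>. pred_on.maxchain P (<) \<Phi>}"

definition adjacent :: "'a set \<Rightarrow> 'a set \<Rightarrow> bool" where
  "adjacent \<Phi> \<Psi> \<longleftrightarrow> card (\<Phi> - \<Psi>) = 1 \<and> card (\<Psi> - \<Phi>) = 1"

definition strongly_flag_connected :: "'a::order set \<Rightarrow> bool" where
  "strongly_flag_connected P \<longleftrightarrow>
     (\<forall>\<Phi>\<in>flags P. \<forall>\<Psi>\<in>flags P. \<exists>(k::nat) (\<Theta> :: nat \<Rightarrow> 'a set).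
        \<Theta> 0 = \<Phi> \<and> \<Theta> k = \<Psi> \<and>
        (\<forall>i\<le>k. \<Theta> i \<in> flags P \<and> \<Phi> \<inter> \<Psi> \<subseteq> \<Theta> i) \<and>
        (\<forall>i<k. adjacent (\<Theta> i) (\<Theta> (Suc i))))"

text \<open>
  The rank \<open>n\<close> is an integer; the axioms force \<open>n \<ge> -1\<close>, the least face to have rank \<open>-1\<close>
  and the greatest face to have rank \<open>n\<close>.
\<close>

locale abstract_polytope =
  fixes P :: "'a::order set" and rank :: "'a \<Rightarrow> int" and n :: int
  assumes rank_strict_mono: "strict_mono_on P rank"
    and rank_onto: "rank ` P = {-1..n}"
    and least_face: "\<exists>F\<in>P. \<forall>G\<in>P. F \<le> G"
    and greatest_face: "\<exists>F\<in>P. \<forall>G\<in>P. G \<le> F"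
    and card_flag: "\<Phi> \<in> flags P \<Longrightarrow> int (card \<Phi>) = n + 2"
    and flag_connected: "strongly_flag_connected P"
    and diamond: "\<lbrakk>F \<in> P; G \<in> P; F < G; rank G = rank F + 2\<rbrakk> \<Longrightarrow>
                    card {H \<in> P. F < H \<and> H < G} = 2"

definition facets :: "'a set \<Rightarrow> ('a \<Rightarrow> int) \<Rightarrow> int \<Rightarrow> 'a set" where
  "facets P rank n = {F \<in> P. rank F = n - 1}"

definition poset_section :: "'a::order set \<Rightarrow> 'a \<Rightarrow> 'a \<Rightarrow> 'a set" where
  "poset_section P G F = {H \<in> P. G \<le> H \<and> H \<le> F}"

definition facet_section :: "'a::order set \<Rightarrow> 'a \<Rightarrow> 'a set" where
  "facet_section P F = poset_section P (LEAST G. G \<in> P) F"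

text \<open>
  Automorphisms are considered up to their values outside of \<open>P\<close>, which are irrelevant.
\<close>

definition automorphism :: "'a::order set \<Rightarrow> ('a \<Rightarrow> 'a) \<Rightarrow> bool" where
  "automorphism P f \<longleftrightarrow> bij_betw f P P \<and> (\<forall>x\<in>P. \<forall>y\<in>P. f x \<le> f y \<longleftrightarrow> x \<le> y)"

definition flag_orbit :: "'a::order set \<Rightarrow> 'a set \<Rightarrow> 'a set set" where
  "flag_orbit P \<Phi> = {f ` \<Phi> | f. automorphism P f}"

definition regular :: "'a::order set \<Rightarrow> bool" where
  "regular P \<longleftrightarrow> (\<forall>\<Phi>\<in>flags P. \<forall>\<Psi>\<in>flags P. \<Psi> \<in> flag_orbit P \<Phi>)"

definition chiral :: "'a::order set \<Rightarrow> bool" where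
  "chiral P \<longleftrightarrow>
     card (flag_orbit P ` flags P) = 2 \<and>
     (\<forall>\<Phi>\<in>flags P. \<forall>\<Psi>\<in>flags P. adjacent \<Phi> \<Psi> \<longrightarrow> flag_orbit P \<Phi> \<noteq> flag_orbit P \<Psi>)"

definition hereditary :: "'a::order set \<Rightarrow> ('a \<Rightarrow> int) \<Rightarrow> int \<Rightarrow> bool" where
  "hereditary P rank n \<longleftrightarrow>
     (\<forall>F\<in>facets P rank n. \<forall>g. automorphism (facet_section P F) g \<longrightarrow>
        (\<exists>f. automorphism P f \<and> (\<forall>H\<in>facet_section P F. f H = g H)))"

end

theory Submission
  imports Defs
begin

text \<open>
  It suffices that regularity passes from a facet \<open>F\<close> to a facet \<open>G\<close> sharing a ridge \<open>R\<close> with it,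
  because flag-connectedness links any two facets by such steps. Choose two adjacent flags of \<open>F\<close>
  through \<open>R\<close> that differ only below \<open>R\<close>. An automorphism of \<open>F\<close> relating them extends to \<open>P\<close>,
  and the extension fixes \<open>F\<close> and \<open>R\<close>, hence also \<open>G\<close>, the only other facet containing \<open>R\<close> by
  the diamond condition. Restricted to \<open>G\<close> it relates two adjacent flags of \<open>G\<close>, so \<open>G\<close> is not
  chiral. In rank at most 2 there is no room below \<open>R\<close>, but there all facets are regular.
\<close>

section \<open>Flags and automorphisms of an arbitrary poset\<close>

lemma chain_iff:
  "pred_on.chain P (<) C \<longleftrightarrow> C \<subseteq> P \<and> (\<forall>x\<in>C. \<forall>y\<in>C. x \<le> y \<or> y \<le> (x::'a::order))"
  unfolding pred_on.chain_def by (auto simp: order_le_less)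

lemma flags_iff:
  "\<Phi> \<in> flags P \<longleftrightarrow> pred_on.chain P (<) \<Phi> \<and> (\<forall>C. pred_on.chain P (<) C \<longrightarrow> \<Phi> \<subseteq> C \<longrightarrow> C = \<Phi>)"
  unfolding flags_def pred_on.maxchain_def by blast

lemma automorphism_comp:
  assumes "automorphism P f" "automorphism P g"
  shows "automorphism P (g \<circ> f)"
proof -
  have "f ` P = P" using assms(1) by (simp add: automorphism_def bij_betw_def)
  then have "f x \<in> P" if "x \<in> P" for x using that by blast
  then show ?thesis
    using assms bij_betw_trans[of f P P g P] by (simp add: automorphism_def)
qed

lemma automorphism_inv:
  assumes "automorphism P f"
  shows "automorphism P (inv_into P f)"
proof -
  have b: "bij_betw f P P" and le: "\<forall>x\<in>P. \<forall>y\<in>P. f x \<le> f y \<longleftrightarrow> x \<le> y"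
    using assms by (auto simp: automorphism_def)
  have b': "bij_betw (inv_into P f) P P" by (rule bij_betw_inv_into[OF b])
  have "inv_into P f x \<in> P" "f (inv_into P f x) = x" if "x \<in> P" for x
    using that b b' by (auto simp: bij_betw_def f_inv_into_f)
  with le b' show ?thesis unfolding automorphism_def by metis
qed

text \<open>Composing on the right with \<open>f\<close>, or with its inverse on \<open>P\<close>,
  turns automorphisms into automorphisms, so both orbits collect the same images. Hence flags
  related by an automorphism have equal orbits as sets, which is the form in which
  \<open>chiral\<close> compares them.\<close>

lemma flag_orbit_image:
  assumes f: "automorphism P f" and "\<Phi> \<subseteq> P"
  shows "flag_orbit P (f ` \<Phi>) = flag_orbit P \<Phi>"
proof
  show "flag_orbit P (f ` \<Phi>) \<subseteq> flag_orbit P \<Phi>"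
    unfolding flag_orbit_def image_comp using automorphism_comp[OF f] by blast
  show "flag_orbit P \<Phi> \<subseteq> flag_orbit P (f ` \<Phi>)"
  proof
    fix \<Psi> assume "\<Psi> \<in> flag_orbit P \<Phi>"
    then obtain g where g: "automorphism P g" "\<Psi> = g ` \<Phi>" by (auto simp: flag_orbit_def)
    have "inj_on f P" using f by (simp add: automorphism_def bij_betw_def)
    then have "inv_into P f ` f ` \<Phi> = \<Phi>" using \<open>\<Phi> \<subseteq> P\<close> by (rule inv_into_image_cancel)
    then have "\<Psi> = (g \<circ> inv_into P f) ` (f ` \<Phi>)" using g by (simp only: image_comp[symmetric])
    then show "\<Psi> \<in> flag_orbit P (f ` \<Phi>)"
      using automorphism_comp[OF automorphism_inv[OF f] g(1)] unfolding flag_orbit_def by blast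
  qed
qed

text \<open>A single automorphism moving one flag to an adjacent one makes their orbits coincide,
  against the second clause of \<open>chiral\<close>.\<close>

lemma adjacent_flags_same_orbit_not_chiral:
  assumes "\<Phi> \<in> flags P" "f ` \<Phi> \<in> flags P" "adjacent \<Phi> (f ` \<Phi>)" "automorphism P f"
  shows "\<not> chiral P"
proof -
  have "\<Phi> \<subseteq> P" using assms(1) by (simp add: flags_iff chain_iff)
  then show ?thesis using assms flag_orbit_image[of P f \<Phi>] unfolding chiral_def by metis
qed

lemma adjacent_insert:
  assumes "x \<notin> A" "y \<notin> A" "x \<noteq> y"
  shows "adjacent (insert x A) (insert y A)"
proof -
  have "insert x A - insert y A = {x}" "insert y A - insert x A = {y}" using assms by auto
  then show ?thesis by (simp add: adjacent_def)
qed

text \<open>Some \<open>z\<close> in \<open>A\<close> is sent to \<open>m\<close>, and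
  \<open>z \<le> m\<close> gives \<open>m \<le> f m\<close>; the converse holds as
  \<open>f m\<close> lies in \<open>B\<close>. Allowing \<open>A\<close> and \<open>B\<close> to
  differ matters for the ridge, where the two sets are different chains with the same greatest
  element.\<close>

lemma monotone_image_greatest:
  fixes m :: "'a::order"
  assumes "\<And>x y. \<lbrakk>x \<in> A; y \<in> A; x \<le> y\<rbrakk> \<Longrightarrow> f x \<le> f y" "f ` A = B"
    and "m \<in> A" "m \<in> B" "\<And>x. x \<in> A \<Longrightarrow> x \<le> m" "\<And>x. x \<in> B \<Longrightarrow> x \<le> m"
  shows "f m = m"
proof -
  obtain z where "z \<in> A" "f z = m" using assms(2,4) by blast
  then have "m \<le> f m" using assms(1,3,5) by metis
  moreover have "f m \<le> m" using assms(2,3,6) by blast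
  ultimately show ?thesis by simp
qed

section \<open>Ranks, chains and flags in a polytope\<close>

context abstract_polytope
begin

lemma rank_less: "\<lbrakk>x \<in> P; y \<in> P; x < y\<rbrakk> \<Longrightarrow> rank x < rank y"
  using rank_strict_mono by (auto simp: strict_mono_on_def)

lemma rank_bounds: "x \<in> P \<Longrightarrow> -1 \<le> rank x" "x \<in> P \<Longrightarrow> rank x \<le> n"
  using rank_onto by auto

lemma chain_rank_le:
  assumes "pred_on.chain P (<) C" "x \<in> C" "y \<in> C" "rank x \<le> rank y"
  shows "x \<le> y"
proof -
  have "x \<le> y \<or> y < x" "x \<in> P" "y \<in> P"
    using assms by (auto simp: chain_iff order_le_less)
  then show ?thesis using rank_less[of y x] assms(4) by auto
qed

lemma chain_rank_less:
  assumes "pred_on.chain P (<) C" "x \<in> C" "y \<in> C" "rank x < rank y"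
  shows "x < y"
  using chain_rank_le[OF assms(1-3)] assms(4) by (auto simp: order_le_less)

lemma chain_rank_inj: "pred_on.chain P (<) C \<Longrightarrow> inj_on rank C"
  by (rule inj_onI) (simp add: chain_rank_le order.antisym)

text \<open>Ranks are injective on a chain, so its size is bounded by the number
  \<open>m + 2\<close> of integers from -1 to \<open>m\<close>.\<close>

lemma chain_card_le:
  assumes "pred_on.chain P (<) C" "\<And>x. x \<in> C \<Longrightarrow> rank x \<le> m" "-1 \<le> m"
  shows "finite C" "int (card C) \<le> m + 2"
proof -
  have sub: "rank ` C \<subseteq> {-1..m}"
    using assms rank_bounds(1) by (auto simp: chain_iff)
  then show "finite C"
    using chain_rank_inj[OF assms(1)] by (meson finite_atLeastAtMost_int finite_imageD finite_subset)
  have "card C \<le> card {-1..m}"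
    using card_inj_on_le[OF chain_rank_inj[OF assms(1)] sub] by simp
  then show "int (card C) \<le> m + 2" using assms(3) by simp
qed

lemma bottom_exists: obtains b where "b \<in> P" "\<And>x. x \<in> P \<Longrightarrow> b \<le> x" "rank b = -1"
    "\<And>x. \<lbrakk>x \<in> P; rank x = -1\<rbrakk> \<Longrightarrow> x = b"
proof -
  obtain b where b: "b \<in> P" "\<And>x. x \<in> P \<Longrightarrow> b \<le> x" using least_face by auto
  have "-1 \<in> rank ` P" using rank_onto rank_bounds[OF b(1)] by auto
  then obtain z where z: "z \<in> P" "rank z = -1" by auto
  have eq: "x = b" if "x \<in> P" "rank x = -1" for x
    using b(2)[OF that(1)] rank_less[OF b(1) that(1)] rank_bounds(1)[OF b(1)] that(2)
    by (auto simp: order_le_less)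
  show ?thesis using that[OF b] eq z by auto
qed

lemma top_exists: obtains t where "t \<in> P" "\<And>x. x \<in> P \<Longrightarrow> x \<le> t" "rank t = n"
proof -
  obtain t where t: "t \<in> P" "\<And>x. x \<in> P \<Longrightarrow> x \<le> t" using greatest_face by auto
  have "n \<in> rank ` P" using rank_onto rank_bounds[OF t(1)] by auto
  then obtain z where z: "z \<in> P" "rank z = n" by auto
  then have "rank t = n"
    using t(2)[OF z(1)] rank_less[OF z(1) t(1)] rank_bounds(2)[OF t(1)]
    by (auto simp: order_le_less)
  with that t show ?thesis by blast
qed

lemma rank_n_ge: "-1 \<le> n"
  using least_face rank_bounds by force

lemma facet_section_eq: "facet_section P F = {H \<in> P. H \<le> F}"
proof -
  obtain b where b: "b \<in> P" "\<And>x. x \<in> P \<Longrightarrow> b \<le> x" using least_face by auto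
  have "(LEAST G. G \<in> P) = b" using b by (intro Least_equality)
  then show ?thesis using b by (auto simp: facet_section_def poset_section_def)
qed

text \<open>The ranks of a flag are distinct and number \<open>n + 2\<close>, which is the size of
  the whole range, so no rank is skipped.\<close>

lemma rank_flag:
  assumes "\<Phi> \<in> flags P"
  shows "rank ` \<Phi> = {-1..n}"
proof (rule card_subset_eq)
  have c: "pred_on.chain P (<) \<Phi>" using assms by (simp add: flags_iff)
  show "rank ` \<Phi> \<subseteq> {-1..n}" using c rank_bounds by (auto simp: chain_iff)
  have "card (rank ` \<Phi>) = card \<Phi>" by (rule card_image[OF chain_rank_inj[OF c]])
  then show "card (rank ` \<Phi>) = card {-1..n}" using card_flag[OF assms] by simp
qed simp

text \<open>Chains have bounded size, so among those through \<open>F\<close> there is one of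
  greatest cardinality. It is a maximal chain, since any chain extending it still contains
  \<open>F\<close>.\<close>

lemma flag_containing:
  assumes "F \<in> P"
  obtains \<Phi> where "\<Phi> \<in> flags P" "F \<in> \<Phi>"
proof -
  let ?Q = "\<lambda>C. pred_on.chain P (<) C \<and> F \<in> C"
  have bound: "finite C" "card C < nat (n + 3)" if C: "pred_on.chain P (<) C" for C
  proof -
    have "rank x \<le> n" if "x \<in> C" for x using C that rank_bounds(2) by (auto simp: chain_iff)
    from chain_card_le[OF C this rank_n_ge] show "finite C" "card C < nat (n + 3)" by auto
  qed
  have "?Q {F}" using assms by (simp add: chain_iff)
  then obtain \<Phi> where \<Phi>: "?Q \<Phi>" "\<And>C. ?Q C \<Longrightarrow> card C \<le> card \<Phi>"
    using ex_has_greatest_nat[of ?Q "{F}" card "nat (n + 3)"] bound(2) by (metis less_imp_le)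
  have "C = \<Phi>" if "pred_on.chain P (<) C" "\<Phi> \<subseteq> C" for C
    using card_seteq[OF bound(1)[OF that(1)] that(2)] \<Phi>(2)[of C] \<Phi>(1) that by auto
  then have "\<Phi> \<in> flags P" using \<Phi>(1) by (simp add: flags_iff)
  with that \<Phi>(1) show ?thesis by blast
qed

text \<open>Maximality by counting: a chain below \<open>F\<close> only has ranks from -1 to
  \<open>n - 1\<close>, hence at most \<open>n + 1\<close> elements, so one that attains this bound
  cannot grow.\<close>

lemma section_flagI:
  assumes F: "F \<in> facets P rank n" and C: "pred_on.chain P (<) C"
    and le: "\<And>x. x \<in> C \<Longrightarrow> x \<le> F" and card: "int (card C) = n + 1"
  shows "C \<in> flags (facet_section P F)"
  unfolding flags_iff
proof (intro conjI allI impI)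
  show "pred_on.chain (facet_section P F) (<) C"
    using C le by (auto simp: chain_iff facet_section_eq)
  fix D assume D: "pred_on.chain (facet_section P F) (<) D" "C \<subseteq> D"
  have FP: "F \<in> P" "rank F = n - 1" using F by (auto simp: facets_def)
  have D': "pred_on.chain P (<) D" using D(1) by (auto simp: chain_iff facet_section_eq)
  have "rank x \<le> n - 1" if "x \<in> D" for x
    using that D(1) FP rank_less[of x F] by (force simp: chain_iff facet_section_eq order_le_less)
  then have "finite D" "int (card D) \<le> n + 1"
    using chain_card_le[OF D', of "n - 1"] rank_bounds(1)[OF FP(1)] FP(2) by auto
  then show "D = C" using card_seteq[OF _ D(2)] card by auto
qed

section \<open>Crossing a ridge between two facets\<close>

text \<open>The bound on \<open>n\<close> ensures that \<Lambda> has faces of ranks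
  \<open>n - 3\<close> and \<open>n - 4\<close>, so that a diamond fits directly below the ridge
  \<open>R\<close>. Only one pair of adjacent flags of \<open>G\<close> is controlled, which is
  enough to refute chirality.\<close>

lemma regular_neighbour_not_chiral:
  assumes her: "hereditary P rank n"
    and \<Lambda>: "\<Lambda> \<in> flags P" "F \<in> \<Lambda>" "R \<in> \<Lambda>" "rank R = n - 2" and n: "3 \<le> n"
    and F: "F \<in> facets P rank n" and G: "G \<in> facets P rank n" "F \<noteq> G" "R < G"
    and reg: "regular (facet_section P F)"
  shows "\<not> chiral (facet_section P G)"
proof -
  have chain: "pred_on.chain P (<) \<Lambda>" using \<Lambda>(1) by (simp add: flags_iff)
  then have \<Lambda>P: "\<Lambda> \<subseteq> P" by (simp add: chain_iff)
  have FP: "F \<in> P" "rank F = n - 1" and GP: "G \<in> P" "rank G = n - 1"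
    using F G by (auto simp: facets_def)
  have RP: "R \<in> P" using \<Lambda> \<Lambda>P by blast
  have RF: "R < F" using chain_rank_less[OF chain \<Lambda>(3,2)] \<Lambda>(4) FP(2) by simp
  have "n - 3 \<in> rank ` \<Lambda>" "n - 4 \<in> rank ` \<Lambda>" using rank_flag[OF \<Lambda>(1)] n by auto
  then obtain x w where x: "x \<in> \<Lambda>" "rank x = n - 3" and w: "w \<in> \<Lambda>" "rank w = n - 4"
    by (auto simp: image_iff)
  have xP: "x \<in> P" "w \<in> P" using x w \<Lambda>P by auto
  have wxR: "w < x" "x < R" using chain_rank_less[OF chain] x w \<Lambda> by auto
  then have "card {H \<in> P. w < H \<and> H < R} = 2"
    using diamond[OF xP(2) RP] w \<Lambda>(4) by auto
  moreover have "x \<in> {H \<in> P. w < H \<and> H < R}" using xP wxR by simp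
  \<comment> \<open>The other face of the diamond between \<open>w\<close> and \<open>R\<close>;
    exchanging \<open>x\<close> for \<open>x'\<close> is the change of flag below the ridge.\<close>
  ultimately obtain x' where x': "x' \<in> P" "w < x'" "x' < R" "x' \<noteq> x"
    by (auto simp: card_2_iff)
  have rx': "rank x' = n - 3"
    using rank_less[OF xP(2) x'(1,2)] rank_less[OF x'(1) RP x'(3)] w \<Lambda>(4) by simp
  \<comment> \<open>The part common to all flags built below, apart from the facet. It involves
    neither \<open>F\<close> nor \<open>G\<close>, so the same \<open>B\<close> serves in both
    sections.\<close>
  define B where "B = {y \<in> \<Lambda>. rank y \<le> n - 2} - {x}"
  have BP: "B \<subseteq> P" and BR: "\<And>y. y \<in> B \<Longrightarrow> y \<le> R" and RB: "R \<in> B"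
    using \<Lambda>P chain_rank_le[OF chain _ \<Lambda>(3)] \<Lambda> x by (auto simp: B_def)
  have x'B: "x' \<notin> B"
    using rx' x x'(4) inj_onD[OF chain_rank_inj[OF chain], of x' x] by (auto simp: B_def)
  have xB: "x \<notin> B" by (simp add: B_def)
  have ins: "insert x B = {y \<in> \<Lambda>. rank y \<le> n - 2}" using x by (auto simp: B_def)
  have "rank ` insert x B = {-1..n - 2}"
  proof -
    have "rank ` insert x B = rank ` \<Lambda> \<inter> {..n - 2}" unfolding ins by auto
    then show ?thesis using rank_flag[OF \<Lambda>(1)] by auto
  qed
  then have card: "int (card (insert x B)) = n"
    using card_image[OF inj_on_subset[OF chain_rank_inj[OF chain], of "insert x B"]] n
    by (auto simp: ins)
  \<comment> \<open>An infinite set would have \<open>card\<close> equal to 0, whereas this one has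
    \<open>n \<ge> 3\<close> elements.\<close>
  have finB: "finite B"
    using card n card.infinite[of "insert x B"] by fastforce
  have compB: "y \<le> z \<or> z \<le> y" if "y \<in> B" "z \<in> B" for y z
    using chain that by (auto simp: B_def chain_iff)
  have comp_z: "y \<le> z \<or> z \<le> y" if y: "y \<in> B" and z: "z \<in> {x, x'}" for y z
  \<comment> \<open>With \<open>x\<close> removed, \<open>B\<close> has no face of rank
    \<open>n - 3\<close>: each of its faces is below or equal to \<open>w\<close>, or else above or
    equal to \<open>R\<close>.\<close>
  proof (cases "rank y \<le> n - 4")
    case True
    then have "y \<le> w" using chain_rank_le[OF chain _ w(1)] y w by (auto simp: B_def)
    then show ?thesis using z wxR x' by force
  next
    case False
    moreover have "rank y \<noteq> n - 3"
      using x y inj_onD[OF chain_rank_inj[OF chain], of y x] by (auto simp: B_def)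
    ultimately have "R \<le> y" using chain_rank_le[OF chain \<Lambda>(3)] y \<Lambda>(4) by (auto simp: B_def)
    then show ?thesis using z wxR x' by force
  qed
  \<comment> \<open>Stated for any facet \<open>H\<close> above \<open>R\<close>, to be used for
    both \<open>F\<close> and \<open>G\<close>.\<close>
  have flag: "insert z (insert H B) \<in> flags (facet_section P H)"
    if H: "H \<in> facets P rank n" "R < H" and z: "z \<in> {x, x'}" for H z
  proof (rule section_flagI[OF H(1)])
    have zP: "z \<in> P" "z \<le> R" "z < H" "z \<notin> B"
      using z xP x' wxR H xB x'B by (auto simp: order.strict_implies_order intro: order.strict_trans)
    have HB: "H \<notin> B" "\<And>y. y \<in> B \<Longrightarrow> y \<le> H"
      using BR H(2) by (auto simp: less_le_not_le intro: order_trans)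
    show "y \<le> H" if "y \<in> insert z (insert H B)" for y
      using that zP HB by auto
    show "pred_on.chain P (<) (insert z (insert H B))"
    proof -
      have "insert z (insert H B) \<subseteq> P" using zP BP H by (simp add: facets_def)
      moreover have "\<forall>y\<in>B. y \<le> z \<or> z \<le> y" "\<forall>y\<in>B. \<forall>y'\<in>B. y \<le> y' \<or> y' \<le> y"
        using compB comp_z[OF _ z] by blast+
      ultimately show ?thesis
        unfolding chain_iff using zP(3) HB(2) by (auto simp: less_imp_le)
    qed
    have "card (insert z (insert H B)) = card (insert x B) + 1"
      using zP HB finB xB by (simp add: order.strict_iff_order)
    then show "int (card (insert z (insert H B))) = n + 1" using card by simp
  qed
  have "insert x' (insert F B) \<in> flag_orbit (facet_section P F) (insert x (insert F B))"
    using reg flag[OF F RF] by (simp add: regular_def)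
  then obtain g where g: "automorphism (facet_section P F) g"
    "g ` insert x (insert F B) = insert x' (insert F B)"
    by (auto simp: flag_orbit_def)
  then obtain f where f: "automorphism P f" "\<And>H. H \<in> facet_section P F \<Longrightarrow> f H = g H"
    using her F unfolding hereditary_def by blast
  have f_bij: "f ` P = P" "inj_on f P" and f_le: "\<And>y z. \<lbrakk>y \<in> P; z \<in> P\<rbrakk> \<Longrightarrow> f y \<le> f z \<longleftrightarrow> y \<le> z"
    using f(1) by (auto simp: automorphism_def bij_betw_def)
  have sub: "insert x B \<subseteq> facet_section P F"
    using BP order.trans[OF BR less_imp_le[OF RF]] xP less_imp_le[OF order.strict_trans[OF wxR(2) RF]]
    by (auto simp: facet_section_eq)
  have FF: "F \<in> facet_section P F" using FP by (simp add: facet_section_eq)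
  have "f ` facet_section P F = g ` facet_section P F" using f(2) by (simp cong: image_cong)
  then have sF: "f ` facet_section P F = facet_section P F"
    using g(1) by (simp add: automorphism_def bij_betw_def)
  have fF: "f F = F"
    by (rule monotone_image_greatest[OF _ sF FF FF]) (simp_all add: f_le facet_section_eq)
  have "f ` insert x (insert F B) = g ` insert x (insert F B)"
    using f(2) sub FF by (intro image_cong) auto
  then have im: "f ` insert F (insert x B) = insert F (insert x' B)"
    using g(2) by (simp only: insert_commute)
  have "F \<notin> B" using BR[of F] RF by (meson less_le_not_le)
  moreover have "F \<noteq> x" "F \<noteq> x'" using RF wxR(2) x'(3) by (metis order.asym)+
  ultimately have nF: "F \<notin> insert x B" "F \<notin> insert x' B" by simp_all
  \<comment> \<open>Removing the fixed face \<open>F\<close> leaves chains whose greatest element is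
    \<open>R\<close>, which forces \<open>f\<close> to fix \<open>R\<close> as well.\<close>
  have "f ` (insert F (insert x B) - {F}) = f ` insert F (insert x B) - f ` {F}"
    by (rule inj_on_image_set_diff[OF f_bij(2)]) (use BP xP(1) FP(1) in blast)+
  then have "f ` (insert F (insert x B) - {F}) = insert F (insert x' B) - {F}"
    unfolding im by (simp only: image_insert image_empty fF)
  then have fB: "f ` insert x B = insert x' B"
    unfolding Diff_insert_absorb[OF nF(1)] Diff_insert_absorb[OF nF(2)] .
  have fR: "f R = R"
  proof (rule monotone_image_greatest[OF _ fB])
    show "f y \<le> f z" if "y \<in> insert x B" "z \<in> insert x B" "y \<le> z" for y z
      using that f_le[of y z] BP xP(1) by blast
  qed (use RB BR wxR(2) x'(3) in \<open>auto intro: less_imp_le\<close>)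
  obtain t where t: "t \<in> P" "\<And>x. x \<in> P \<Longrightarrow> x \<le> t" "rank t = n" using top_exists by blast
  have ft: "f t = t"
    by (rule monotone_image_greatest[OF _ f_bij(1)]) (use t(1,2) f_le in blast)+
  have f_less: "f y < f z" if "y \<in> P" "z \<in> P" "y < z" for y z
    using that f_le by (simp add: less_le_not_le)
  have lt: "F < t" "G < t"
    using t(2)[OF FP(1)] t(2)[OF GP(1)] t(3) FP(2) GP(2) by (auto simp: order_le_less)
  \<comment> \<open>The diamond between \<open>R\<close> and the greatest face \<open>t\<close>
    consists of \<open>F\<close> and \<open>G\<close> alone. As \<open>f\<close> fixes
    \<open>R\<close> and \<open>t\<close>, it maps \<open>G\<close> into this set, and injectivity
    rules out \<open>F\<close>.\<close>
  define S where "S = {H \<in> P. R < H \<and> H < t}"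
  have "R < f G" using f_less[OF RP GP(1) G(3)] unfolding fR .
  moreover have "f G < t" using f_less[OF GP(1) t(1) lt(2)] unfolding ft .
  moreover have "f G \<in> P" using f_bij(1) GP(1) by blast
  ultimately have S: "f G \<in> S" "F \<in> S" "G \<in> S"
    using FP(1) GP(1) RF G(3) lt by (simp_all add: S_def)
  have "card S = 2"
    unfolding S_def using diamond[OF RP t(1) order.strict_trans[OF RF lt(1)]] t(3) \<Lambda>(4) by simp
  then obtain p q where "S = {p, q}" by (meson card_2_iff)
  then have "f G = F \<or> f G = G" using S G(2) by auto
  moreover have "f G \<noteq> F" using fF inj_onD[OF f_bij(2), of G F] FP(1) GP(1) G(2) by metis
  ultimately have fG: "f G = G" by blast
  have "f ` facet_section P G = facet_section P G"
  proof
    show "f ` facet_section P G \<subseteq> facet_section P G"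
      using f_bij(1) f_le[OF _ GP(1)] fG by (auto simp: facet_section_eq)
    show "facet_section P G \<subseteq> f ` facet_section P G"
    proof
      fix y assume y: "y \<in> facet_section P G"
      then obtain z where "z \<in> P" "y = f z" using f_bij(1) by (auto simp: facet_section_eq)
      with y show "y \<in> f ` facet_section P G"
        using f_le[OF _ GP(1), of z] fG by (auto simp: facet_section_eq)
    qed
  qed
  then have autG: "automorphism (facet_section P G) f"
    using f_le inj_on_subset[OF f_bij(2), of "facet_section P G"]
    unfolding automorphism_def bij_betw_def by (simp add: facet_section_eq)
  \<comment> \<open>The same exchange of \<open>x\<close> for \<open>x'\<close>, now read in a flag
    of \<open>G\<close>.\<close>
  have "f ` insert G (insert x B) = insert G (insert x' B)"
    using fB fG by (simp only: image_insert[of f G])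
  then have img: "f ` insert x (insert G B) = insert x' (insert G B)"
    by (simp only: insert_commute)
  have "x \<noteq> G" "x' \<noteq> G" using x(2) rx' GP(2) by auto
  then have "adjacent (insert x (insert G B)) (insert x' (insert G B))"
    using xB x'B x'(4) by (intro adjacent_insert) simp_all
  then show ?thesis
    using adjacent_flags_same_orbit_not_chiral[OF flag[OF G(1,3), of x] _ _ autG]
      flag[OF G(1,3), of x'] unfolding img by simp
qed

text \<open>For \<open>n = 2\<close> a facet is an edge with two vertices, and swapping them relates
  two adjacent flags. For smaller \<open>n\<close> the section is a chain, so there is at most one
  flag and hence fewer than two orbits.\<close>

lemma low_rank_facet_not_chiral:
  assumes n: "n \<le> 2" and F: "F \<in> facets P rank n"
  shows "\<not> chiral (facet_section P F)"
proof -
  have FP: "F \<in> P" "rank F = n - 1" using F by (auto simp: facets_def)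
  obtain b where b: "b \<in> P" "\<And>x. x \<in> P \<Longrightarrow> b \<le> x" "rank b = -1"
    "\<And>x. \<lbrakk>x \<in> P; rank x = -1\<rbrakk> \<Longrightarrow> x = b" using bottom_exists by blast
  have below: "rank x < n - 1" if "x \<in> facet_section P F" "x \<noteq> F" for x
    using that rank_less[of x F] FP by (auto simp: facet_section_eq order_le_less)
  show ?thesis
  proof (cases "n = 2")
    case True
    have bF: "b < F" using b(2)[OF FP(1)] b(3) FP True by (auto simp: order_le_less)
    have "card {H \<in> P. b < H \<and> H < F} = 2"
      using diamond[OF b(1) FP(1) bF] b(3) FP True by simp
    then obtain u v where uv: "{H \<in> P. b < H \<and> H < F} = {u, v}" "u \<noteq> v"
      by (auto simp: card_2_iff)
    then have u: "u \<in> P" "b < u" "u < F" and v: "v \<in> P" "b < v" "v < F" by auto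
    have "rank u = 0" "rank v = 0"
      using rank_less[OF b(1) u(1,2)] rank_less[OF u(1) FP(1) u(3)]
        rank_less[OF b(1) v(1,2)] rank_less[OF v(1) FP(1) v(3)] b(3) FP True by auto
    then have inc: "\<not> u \<le> v" "\<not> v \<le> u"
      using rank_less[OF u(1) v(1)] rank_less[OF v(1) u(1)] uv(2) by (auto simp: order_le_less)
    have sec: "facet_section P F = {b, u, v, F}"
    proof
      show "facet_section P F \<subseteq> {b, u, v, F}"
      proof
        fix x assume "x \<in> facet_section P F"
        then have "x = b \<or> x = F \<or> x \<in> {H \<in> P. b < H \<and> H < F}"
          using b(2)[of x] by (auto simp: facet_section_eq order_le_less)
        then show "x \<in> {b, u, v, F}" unfolding uv(1) by blast
      qed
      show "{b, u, v, F} \<subseteq> facet_section P F"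
        using b(1) u v FP(1) bF by (auto simp: facet_section_eq)
    qed
    define s where "s = id(u := v, v := u)"
    have s: "s u = v" "s v = u" "s b = b" "s F = F" using u v uv(2) by (auto simp: s_def)
    have ne: "\<not> F \<le> u" "\<not> F \<le> v" "\<not> F \<le> b" "\<not> u \<le> b" "\<not> v \<le> b" "b \<le> u" "b \<le> v" "b \<le> F" "u \<le> F" "v \<le> F"
      using u v bF by (auto simp: less_le_not_le)
    have aut: "automorphism (facet_section P F) s"
    proof -
      have "inj_on s {b, u, v, F}" using uv(2) ne by (auto simp: inj_on_def s)
      moreover have "s ` {b, u, v, F} = {b, u, v, F}" by (auto simp: s)
      moreover have "\<forall>x\<in>{b, u, v, F}. \<forall>y\<in>{b, u, v, F}. s x \<le> s y \<longleftrightarrow> x \<le> y"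
        by (simp add: s inc ne)
      ultimately show ?thesis by (simp only: automorphism_def bij_betw_def sec simp_thms)
    qed
    have flag: "insert z {b, F} \<in> flags (facet_section P F)" if "z = u \<or> z = v" for z
    proof (rule section_flagI[OF F])
      have "z \<noteq> b" "z \<noteq> F" "b \<noteq> F" using that u v bF by auto
      then have "card {z, b, F} = 3" by simp
      then show "int (card (insert z {b, F})) = n + 1" using True by simp
    qed (use that b(1) u v bF FP(1) in \<open>auto simp: chain_iff less_imp_le\<close>)
    have "s ` insert u {b, F} = insert v {b, F}" using s by simp
    moreover have "adjacent (insert u {b, F}) (insert v {b, F})"
      using u v uv(2) by (intro adjacent_insert) auto
    ultimately show ?thesis
      using adjacent_flags_same_orbit_not_chiral[OF flag[of u] _ _ aut] flag[of v] by simp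
  next
    case False
    then have "x = b" if "x \<in> facet_section P F" "x \<noteq> F" for x
      using below[OF that] that b(4)[of x] rank_bounds(1)[of x] n by (auto simp: facet_section_eq)
    then have "pred_on.chain (facet_section P F) (<) (facet_section P F)"
      unfolding chain_iff by (metis facet_section_eq FP(1) b(2) order_refl subset_refl)
    then have "\<Phi> = facet_section P F" if "\<Phi> \<in> flags (facet_section P F)" for \<Phi>
      using that by (auto simp: flags_iff chain_iff)
    then have "flags (facet_section P F) \<subseteq> {facet_section P F}" by blast
    then have "card (flag_orbit (facet_section P F) ` flags (facet_section P F)) \<le> 1"
      using subset_singletonD by fastforce
    then show ?thesis by (simp add: chiral_def)
  qed
qed

section \<open>Propagation along a sequence of flags\<close>

lemma regular_transfer:
  assumes her: "hereditary P rank n"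
    and dich: "\<And>F. F \<in> facets P rank n \<Longrightarrow>
           regular (facet_section P F) \<or> chiral (facet_section P F)"
    and F: "F \<in> facets P rank n" "regular (facet_section P F)" and G: "G \<in> facets P rank n"
  shows "regular (facet_section P G)"
proof (cases "n \<le> 2")
  case True
  then show ?thesis using low_rank_facet_not_chiral G dich by blast
next
  case False
  have FG: "F \<in> P" "G \<in> P" using F(1) G by (auto simp: facets_def)
  obtain \<Phi> where \<Phi>: "\<Phi> \<in> flags P" "F \<in> \<Phi>" by (rule flag_containing[OF FG(1)])
  obtain \<Psi> where \<Psi>: "\<Psi> \<in> flags P" "G \<in> \<Psi>" by (rule flag_containing[OF FG(2)])
  have "\<exists>(k::nat) \<Theta>. \<Theta> 0 = \<Phi> \<and> \<Theta> k = \<Psi> \<and> (\<forall>i\<le>k. \<Theta> i \<in> flags P \<and> \<Phi> \<inter> \<Psi> \<subseteq> \<Theta> i) \<and>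
      (\<forall>i<k. adjacent (\<Theta> i) (\<Theta> (Suc i)))"
    using flag_connected \<Phi>(1) \<Psi>(1) unfolding strongly_flag_connected_def by simp
  then obtain k :: nat and \<Theta> where \<Theta>: "\<Theta> 0 = \<Phi>" "\<Theta> k = \<Psi>"
    "\<And>i. i \<le> k \<Longrightarrow> \<Theta> i \<in> flags P" "\<And>i. i < k \<Longrightarrow> adjacent (\<Theta> i) (\<Theta> (Suc i))"
    by (elim exE conjE) simp
  have unique: "H = H'" if "\<Lambda> \<in> flags P" "H \<in> \<Lambda>" "H' \<in> \<Lambda>" "rank H = rank H'" for \<Lambda> H H'
    using that inj_onD[OF chain_rank_inj] by (auto simp: flags_iff)
  \<comment> \<open>Each flag contains exactly one facet, so the invariant says that the facet of
    every \<Theta> \<open>i\<close> is regular.\<close>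
  have "\<forall>H \<in> \<Theta> i \<inter> facets P rank n. regular (facet_section P H)" if "i \<le> k" for i
    using that
  proof (induction i)
    case 0
    then show ?case using unique[OF \<Phi>(1,2)] \<Theta>(1) F by (auto simp: facets_def)
  next
    case (Suc i)
    show ?case
    proof
      fix H assume H: "H \<in> \<Theta> (Suc i) \<inter> facets P rank n"
      have fl: "\<Theta> i \<in> flags P" "\<Theta> (Suc i) \<in> flags P" using \<Theta>(3) Suc.prems by auto
      have "n - 1 \<in> rank ` \<Theta> i" "n - 2 \<in> rank ` \<Theta> i" using rank_flag[OF fl(1)] False by auto
      then obtain E R where E: "E \<in> \<Theta> i" "rank E = n - 1" and R: "R \<in> \<Theta> i" "rank R = n - 2"
        by (auto simp: image_iff)
      have EF: "E \<in> facets P rank n"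
        using E fl(1) by (auto simp: facets_def flags_iff chain_iff)
      have regE: "regular (facet_section P E)" using Suc EF E by auto
      show "regular (facet_section P H)"
      proof (cases "E = H")
        case True
        then show ?thesis using regE by simp
      next
        case ne: False
        \<comment> \<open>Adjacent flags differ in one face. If the facet \<open>E\<close> is the
          one lost, the ridge \<open>R\<close> survives and lies below the new facet
          \<open>H\<close>.\<close>
        have "card (\<Theta> i - \<Theta> (Suc i)) = 1"
          using \<Theta>(4)[of i] Suc.prems by (simp add: adjacent_def)
        moreover have "E \<in> \<Theta> i - \<Theta> (Suc i)"
          using E H ne unique[OF fl(2), of E H] by (auto simp: facets_def)
        ultimately have "\<Theta> i - \<Theta> (Suc i) = {E}" by (metis card_1_singletonE singletonD)
        moreover have "R \<noteq> E" using E(2) R(2) by auto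
        ultimately have "R \<in> \<Theta> (Suc i)" using R(1) by blast
        then have "R < H"
          using chain_rank_less[of "\<Theta> (Suc i)" R H] fl(2) H R by (auto simp: flags_iff facets_def)
        then have "\<not> chiral (facet_section P H)"
          using regular_neighbour_not_chiral[OF her fl(1) E(1) R _ EF _ ne _ regE] H False by auto
        then show ?thesis using dich H by blast
      qed
    qed
  qed
  then show ?thesis using \<Theta>(2) \<Psi> G by auto
qed

end

text \<open>One regular facet makes all facets regular by \<open>regular_transfer\<close>; if there
  is none, the dichotomy leaves only chiral ones.\<close>

theorem theorem1:
  fixes P :: "'a::order set" and rank :: "'a \<Rightarrow> int" and n :: int
  assumes "abstract_polytope P rank n"
    and "hereditary P rank n"
    and "\<And>F. F \<in> facets P rank n \<Longrightarrow>
           regular (facet_section P F) \<or> chiral (facet_section P F)"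
  shows "(\<forall>F\<in>facets P rank n. regular (facet_section P F)) \<or>
         (\<forall>F\<in>facets P rank n. chiral (facet_section P F))"
  using abstract_polytope.regular_transfer[OF assms(1,2)] assms(3) by blast

end
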